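(* For $n=3$ and each $k\in\{3,4\}$, and for $n=4$ and each $k\in\{4,5,6,7,8,9,10,11\}$, there is exactly one switching equivalence class of Parseval frames for $\mathbb Z_2^n$ with $k$ vectors that are not trivially redundant.
   Context: $\mathbb Z_2$ is the field with two elements. The dot product on $\mathbb Z_2^n$ is $(a,b)=\sum_{i=1}^n a_ib_i\in\mathbb Z_2$. A family (finite indexed list) $\{f_1,\dots,f_k\}$ of vectors in $\mathbb Z_2^n$ is a Parseval frame for $\mathbb Z_2^n$ if $x=\sum_{j=1}^k (x,f_j)f_j$ for all $x\in\mathbb Z_2^n$. A Parseval frame $\{f_1,\dots,f_k\}$ is trivially redundant if some $f_j=0$ or if there are two indices $i\ne j$ with $f_i=f_j$. A matrix $U\in M_n(\mathbb Z_2)$ is unitary if it is invertible and $U^{-1}=U^*$, where $U^*$ is the transpose of $U$. Two families $\{f_1,\dots,f_k\}$ and $\{g_1,\dots,g_k\}$ in $\mathbb Z_2^n$ are switching equivalent if there are a unitary $U\in M_n(\mathbb Z_2)$ and a permutation $\pi$ of $\{1,\dots,k\}$ such that $f_j=Ug_{\pi(j)}$ for all $j\in\{1,\dots,k\}$; this is an equivalence relation. *)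

theory Defs
  imports "HOL-Analysis.Cartesian_Space" "HOL-Library.Z2" "HOL-Combinatorics.Permutations"
begin

text \<open>A finite indexed family in \<open>\<int>\<^sub>2\<^sup>n\<close> is a list over \<^typ>\<open>bit ^ 'n\<close>, where \<open>n = CARD('n)\<close>; its index set
  \<open>{1,\<dots>,k}\<close> is shifted to \<open>{..<k}\<close>.\<close>

definition dot :: "bit ^ 'n \<Rightarrow> bit ^ 'n \<Rightarrow> bit" where
  "dot a b = (\<Sum>i\<in>UNIV. a $ i * b $ i)"

definition parseval_frame :: "(bit ^ 'n) list \<Rightarrow> bool" where
  "parseval_frame fs \<longleftrightarrow> (\<forall>x. x = (\<Sum>j<length fs. dot x (fs ! j) *s (fs ! j)))"

definition trivially_redundant :: "(bit ^ 'n) list \<Rightarrow> bool" where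
  "trivially_redundant fs \<longleftrightarrow>
     (\<exists>j<length fs. fs ! j = 0) \<or>
     (\<exists>i<length fs. \<exists>j<length fs. i \<noteq> j \<and> fs ! i = fs ! j)"

definition unitary :: "bit ^ 'n ^ 'n \<Rightarrow> bool" where
  "unitary U \<longleftrightarrow> invertible U \<and> matrix_inv U = transpose U"

definition switching_equivalent :: "(bit ^ 'n) list \<Rightarrow> (bit ^ 'n) list \<Rightarrow> bool" where
  "switching_equivalent fs gs \<longleftrightarrow>
     length fs = length gs \<and>
     (\<exists>U \<pi>. unitary U \<and> \<pi> permutes {..<length fs} \<and>
       (\<forall>j<length fs. fs ! j = U *v (gs ! \<pi> j)))"

definition switching_rel :: "((bit ^ 'n) list \<times> (bit ^ 'n) list) set" where
  "switching_rel = {(fs, gs). switching_equivalent fs gs}"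

definition nonredundant_parseval_frames :: "nat \<Rightarrow> (bit ^ 'n) list set" where
  "nonredundant_parseval_frames k =
     {fs. length fs = k \<and> parseval_frame fs \<and> \<not> trivially_redundant fs}"

lemma unitary_iff: "unitary U \<longleftrightarrow> U ** transpose U = mat 1 \<and> transpose U ** U = mat 1"
proof
  assume "unitary U"
  then have "invertible U" and eq: "matrix_inv U = transpose U"
    by (auto simp: unitary_def)
  then have "\<exists>V. U ** V = mat 1 \<and> V ** U = mat 1"
    by (simp add: invertible_def)
  then have "U ** matrix_inv U = mat 1 \<and> matrix_inv U ** U = mat 1"
    unfolding matrix_inv_def by (rule someI_ex)
  then show "U ** transpose U = mat 1 \<and> transpose U ** U = mat 1"
    by (simp add: eq)
next
  assume *: "U ** transpose U = mat 1 \<and> transpose U ** U = mat 1"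
  then have inv: "invertible U" by (auto simp: invertible_def)
  then have "\<exists>V. U ** V = mat 1 \<and> V ** U = mat 1"
    by (simp add: invertible_def)
  then have "U ** matrix_inv U = mat 1 \<and> matrix_inv U ** U = mat 1"
    unfolding matrix_inv_def by (rule someI_ex)
  then have "matrix_inv U = transpose U"
    by (metis * matrix_mul_assoc matrix_mul_lid matrix_mul_rid)
  with inv show "unitary U" by (simp add: unitary_def)
qed

lemma switching_equivalent_refl: "switching_equivalent fs fs"
  unfolding switching_equivalent_def
  by (intro conjI refl exI[of _ "mat 1"] exI[of _ id])
    (auto simp: unitary_iff transpose_mat permutes_id)

lemma switching_equivalent_sym:
  assumes "switching_equivalent fs gs"
  shows "switching_equivalent gs fs"
proof -
  from assms obtain U \<pi> where len: "length fs = length gs" and U: "unitary U"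
    and p: "\<pi> permutes {..<length fs}" and e: "\<And>j. j < length fs \<Longrightarrow> fs ! j = U *v (gs ! \<pi> j)"
    by (auto simp: switching_equivalent_def)
  have "gs ! j = transpose U *v (fs ! inv \<pi> j)" if "j < length gs" for j
  proof -
    have "inv \<pi> j < length fs"
      using permutes_in_image[OF permutes_inv[OF p]] that len by simp
    then have "fs ! inv \<pi> j = U *v (gs ! j)"
      using e permutes_inverses(1)[OF p] by simp
    then show ?thesis
      using U by (simp add: unitary_iff matrix_vector_mul_assoc)
  qed
  moreover have "unitary (transpose U)" using U by (simp add: unitary_iff transpose_transpose)
  ultimately show ?thesis
    using len permutes_inv[OF p] unfolding switching_equivalent_def by metis
qed

lemma switching_equivalent_trans:
  assumes "switching_equivalent fs gs" "switching_equivalent gs hs"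
  shows "switching_equivalent fs hs"
proof -
  from assms(1) obtain U \<pi> where 1: "length fs = length gs" "unitary U"
    "\<pi> permutes {..<length fs}" "\<And>j. j < length fs \<Longrightarrow> fs ! j = U *v (gs ! \<pi> j)"
    by (auto simp: switching_equivalent_def)
  from assms(2) obtain V \<rho> where 2: "length gs = length hs" "unitary V"
    "\<rho> permutes {..<length gs}" "\<And>j. j < length gs \<Longrightarrow> gs ! j = V *v (hs ! \<rho> j)"
    by (auto simp: switching_equivalent_def)
  have "fs ! j = (U ** V) *v (hs ! (\<rho> \<circ> \<pi>) j)" if "j < length fs" for j
    using that 1(1,4) 2(4) permutes_in_image[OF 1(3), of j]
    by (simp add: matrix_vector_mul_assoc)
  moreover have "unitary (U ** V)"
    using 1(2) 2(2) unfolding unitary_iff matrix_transpose_mul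
    by (metis matrix_mul_assoc matrix_mul_lid)
  moreover have "(\<rho> \<circ> \<pi>) permutes {..<length fs}"
    using 1 2 by (auto intro: permutes_compose)
  ultimately show ?thesis
    using 1(1) 2(1) unfolding switching_equivalent_def by metis
qed

lemma equiv_switching_rel: "equiv UNIV switching_rel"
  by (intro equivI refl_onI symI transI)
    (auto simp: switching_rel_def switching_equivalent_refl
      intro: switching_equivalent_sym switching_equivalent_trans)

end

theory Submission
  imports Defs
begin

text \<open>A frame that is not trivially redundant is a set \<open>F\<close> of nonzero vectors, and it is Parseval iff
  \<open>\<Sum>\<^sub>v v\<^sub>p v\<^sub>q = \<delta>\<^sub>p\<^sub>q\<close> over \<open>v \<in> F\<close>. The standard basis \<open>E\<close> is one solution, so the indicator of any other
  differs from that of \<open>E\<close>, away from \<open>0\<close>, by a function orthogonal to all products of two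
  coordinates. By Reed--Muller duality such a function is constant for \<open>n = 3\<close> and affine,
  \<open>x \<mapsto> a \<cdot> x + b\<close>, for \<open>n = 4\<close>. Coordinate permutations act transitively on the \<open>a\<close> of a given
  weight, and the number of vectors determines \<open>b\<close> and the weight of \<open>a\<close>, except that weights \<open>0\<close>
  and \<open>4\<close> give frames of the same size; these are exchanged by the unitary matrix with zero diagonal
  and all other entries \<open>1\<close>.\<close>

text \<open>These two simplification rules turn the field operations into bitwise ones, which disables
  ring normalization.\<close>

declare add_bit_eq_xor [simp del] mult_bit_eq_and [simp del]

section \<open>Arithmetic in \<open>bit\<close> and enumeration of small vector spaces\<close>

lemma bit_add_self [simp]: "(b :: bit) + b = 0"
  by (cases b) simp_all

lemma bit_add_left_self [simp]: "(b :: bit) + (b + c) = c"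
  by (simp flip: add.assoc)

lemma bit_add_1_eq_0 [simp]: "(b :: bit) + 1 = 0 \<longleftrightarrow> b = 1" "1 + (b :: bit) = 0 \<longleftrightarrow> b = 1"
  by (cases b; simp)+

lemma UNIV_bit: "(UNIV :: bit set) = {0, 1}"
  using bit.exhaust by auto

text \<open>Makes \<open>bit ^ 'n\<close> finite, so that sums over all vectors are genuine.\<close>

instance bit :: finite
  by standard (simp add: UNIV_bit)

lemma all_bit: "(\<forall>b :: bit. P b) \<longleftrightarrow> P 0 \<and> P 1"
  by (metis bit.exhaust)

lemma vector_4 [simp]:
  "(vector [a, b, c, d] :: 'a::zero^4) $ 1 = a"
  "(vector [a, b, c, d] :: 'a::zero^4) $ 2 = b"
  "(vector [a, b, c, d] :: 'a::zero^4) $ 3 = c"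
  "(vector [a, b, c, d] :: 'a::zero^4) $ 4 = d"
  by (simp_all add: vector_def)

lemma vector_4_components: "vector [x $ 1, x $ 2, x $ 3, x $ 4] = (x :: 'a::zero^4)"
  by (simp add: vec_eq_iff forall_4)

lemma vector_3_components: "vector [x $ 1, x $ 2, x $ 3] = (x :: 'a::zero^3)"
  by (simp add: vec_eq_iff forall_3)

lemma forall_vector_4: "(\<forall>x :: 'a::zero^4. P x) \<longleftrightarrow> (\<forall>a b c d. P (vector [a, b, c, d]))"
  by (metis vector_4_components)

lemma sum_bit_4:
  fixes f :: "bit ^ 4 \<Rightarrow> 'a :: comm_monoid_add"
  shows "(\<Sum>x\<in>UNIV. f x) =
    (\<Sum>a\<in>{0, 1}. \<Sum>b\<in>{0, 1}. \<Sum>c\<in>{0, 1}. \<Sum>d\<in>{0, 1}. f (vector [a, b, c, d]))"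
proof -
  have "bij_betw (\<lambda>(a, b, c, d). vector [a, b, c, d] :: bit ^ 4) UNIV UNIV"
    by (rule bij_betw_byWitness[where f' = "\<lambda>x. (x $ 1, x $ 2, x $ 3, x $ 4)"])
      (auto simp: vector_4_components)
  then have "(\<Sum>x\<in>UNIV. f x) = (\<Sum>(a, b, c, d)\<in>UNIV. f (vector [a, b, c, d]))"
    by (simp add: sum.reindex_bij_betw[symmetric] case_prod_unfold)
  then show ?thesis
    by (simp only: sum.cartesian_product UNIV_bit[symmetric] UNIV_Times_UNIV)
qed

lemma sum_bit_3:
  fixes f :: "bit ^ 3 \<Rightarrow> 'a :: comm_monoid_add"
  shows "(\<Sum>x\<in>UNIV. f x) =
    (\<Sum>a\<in>{0, 1}. \<Sum>b\<in>{0, 1}. \<Sum>c\<in>{0, 1}. f (vector [a, b, c]))"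
proof -
  have "bij_betw (\<lambda>(a, b, c). vector [a, b, c] :: bit ^ 3) UNIV UNIV"
    by (rule bij_betw_byWitness[where f' = "\<lambda>x. (x $ 1, x $ 2, x $ 3)"])
      (auto simp: vector_3_components)
  then have "(\<Sum>x\<in>UNIV. f x) = (\<Sum>(a, b, c)\<in>UNIV. f (vector [a, b, c]))"
    by (simp add: sum.reindex_bij_betw[symmetric] case_prod_unfold)
  then show ?thesis
    by (simp only: sum.cartesian_product UNIV_bit[symmetric] UNIV_Times_UNIV)
qed

section \<open>Nonredundant frames as sets of vectors\<close>

definition parseval_set :: "(bit ^ 'n) set \<Rightarrow> bool" where
  "parseval_set F \<longleftrightarrow> (\<forall>p q. (\<Sum>v\<in>F. v $ p * v $ q) = of_bool (p = q))"

lemma parseval_frame_iff_parseval_set: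
  fixes fs :: "(bit ^ 'n) list"
  assumes "distinct fs"
  shows "parseval_frame fs \<longleftrightarrow> parseval_set (set fs)"
proof -
  have reindex: "(\<Sum>j<length fs. dot x (fs ! j) *s (fs ! j)) = (\<Sum>v\<in>set fs. dot x v *s v)" for x
    using bij_betw_nth[OF assms refl refl]
    by (rule sum.reindex_bij_betw[where g = "\<lambda>v. dot x v *s v"])
  have expand: "(\<Sum>v\<in>set fs. dot x v *s v) $ p = (\<Sum>q\<in>UNIV. x $ q * (\<Sum>v\<in>set fs. v $ p * v $ q))"
    for x p
    by (simp add: dot_def sum_distrib_left sum_distrib_right mult_ac sum.swap[of _ "set fs"])
  show ?thesis
  proof
    assume *: "parseval_frame fs"
    have "(\<Sum>v\<in>set fs. v $ p * v $ q) = of_bool (p = q)" for p q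
    proof -
      \<comment> \<open>The reconstruction formula at the unit vector \<open>axis q 1\<close>
        isolates one entry of the frame operator.\<close>
      have "axis q 1 $ p = (\<Sum>r\<in>UNIV. axis q 1 $ r * (\<Sum>v\<in>set fs. v $ p * v $ r))"
        using * unfolding parseval_frame_def by (metis reindex expand)
      also have "\<dots> = (\<Sum>r\<in>UNIV. if r = q then \<Sum>v\<in>set fs. v $ p * v $ r else 0)"
        by (intro sum.cong) (auto simp: axis_def)
      finally show ?thesis by (auto simp: axis_def)
    qed
    then show "parseval_set (set fs)" by (simp add: parseval_set_def)
  next
    assume *: "parseval_set (set fs)"
    show "parseval_frame fs"
      unfolding parseval_frame_def reindex vec_eq_iff expand
      using * by (auto simp: parseval_set_def of_bool_def if_distrib[of "times _"] cong: if_cong)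
  qed
qed

text \<open>Makes the Parseval condition a linear system in the values of the indicator of
  \<open>F\<close>.\<close>

lemma sum_times_indicator:
  fixes F :: "'a :: finite set" and f :: "'a \<Rightarrow> 'b :: semiring_1"
  shows "sum f F = (\<Sum>v\<in>UNIV. of_bool (v \<in> F) * f v)"
  by (simp add: of_bool_def if_distrib[of "\<lambda>c. c * _"] sum.If_cases cong: if_cong)

lemma not_trivially_redundant_iff: "\<not> trivially_redundant fs \<longleftrightarrow> distinct fs \<and> 0 \<notin> set fs"
  by (auto simp: trivially_redundant_def distinct_conv_nth in_set_conv_nth)

lemma transpose_unitary_cancel:
  assumes "unitary U"
  shows "transpose U *v (U *v x) = x"
  using assms by (simp add: unitary_iff matrix_vector_mul_assoc)

text \<open>As \<open>U\<close> is injective, \<open>fs\<close> and the image of \<open>gs\<close>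
  are distinct lists with the same set, hence the same multiset; this yields the
  permutation.\<close>

lemma switching_equivalentI:
  assumes "unitary U" "distinct fs" "distinct gs" "set fs = (*v) U ` set gs"
  shows "switching_equivalent fs gs"
proof -
  have "inj ((*v) U)"
    using transpose_unitary_cancel[OF \<open>unitary U\<close>] by (rule inj_on_inverseI)
  then have "distinct (map ((*v) U) gs)"
    using assms(3) by (simp add: distinct_map inj_on_subset[OF _ subset_UNIV])
  then have "mset fs = mset (map ((*v) U) gs)"
    using assms by (metis list.set_map set_eq_iff_mset_eq_distinct)
  then obtain p where p: "p permutes {..<length gs}" "permute_list p (map ((*v) U) gs) = fs"
    using mset_eq_permutation by (metis length_map)
  have "length fs = length gs" using p(2) by auto
  moreover have "fs ! j = U *v (gs ! p j)" if "j < length fs" for j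
    using p that permute_list_nth[of p "map ((*v) U) gs" j] permutes_in_image[OF p(1), of j]
    by auto
  ultimately show ?thesis
    using assms(1) p(1) unfolding switching_equivalent_def by metis
qed

section \<open>Classification by affine functions\<close>

definition weight :: "bit ^ 'n \<Rightarrow> nat" where
  "weight x = card {i. x $ i = 1}"

lemma weight_eq_sum: "weight x = (\<Sum>i\<in>UNIV. of_bool (x $ i = 1))"
  by (simp add: weight_def)

text \<open>\<open>weight x = 1\<close> says that \<open>x\<close> belongs to the standard basis.\<close>
definition affine_frame :: "bit ^ 'n \<Rightarrow> bit \<Rightarrow> (bit ^ 'n) set" where
  "affine_frame a b = {x. x \<noteq> 0 \<and> of_bool (weight x = 1) + dot a x + b = 1}"

lemma affine_frame_eqI:
  assumes "0 \<notin> F"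
    and "\<And>x. x \<noteq> 0 \<Longrightarrow> of_bool (x \<in> F) = of_bool (weight x = 1) + dot a x + b"
  shows "F = affine_frame a b"
proof -
  have "x \<in> F \<longleftrightarrow> x \<noteq> 0 \<and> of_bool (weight x = 1) + dot a x + b = 1" for x
    using assms(1) assms(2)[of x] by (cases "x = 0"; cases "x \<in> F") auto
  then show ?thesis unfolding affine_frame_def by blast
qed

text \<open>Six equations leave one of the seven values of \<open>h\<close> at nonzero vectors free.
  The all-ones vector, where the basis indicator vanishes, reads off \<open>b\<close>.\<close>

lemma parseval_set_eq_affine_frame_3:
  fixes F :: "(bit ^ 3) set"
  assumes F: "parseval_set F" "0 \<notin> F"
  shows "\<exists>b. F = affine_frame 0 b"
proof -
  define h :: "bit ^ 3 \<Rightarrow> bit" where "h x = of_bool (x \<in> F)" for x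
  have eq: "(\<Sum>v\<in>UNIV. h v * (v $ p * v $ q)) = of_bool (p = q)" for p q
    using F(1) unfolding parseval_set_def sum_times_indicator[of _ F] h_def by blast
  have "\<forall>x. x \<noteq> 0 \<longrightarrow> h x = of_bool (weight x = 1) + dot 0 x + h (vector [1, 1, 1])"
    using eq[of 1 1] eq[of 1 2] eq[of 1 3] eq[of 2 2] eq[of 2 3] eq[of 3 3]
    unfolding forall_vector_3 all_bit
    by (cases "h (vector [1, 1, 1])")
      (simp_all add: sum_bit_3 vec_eq_iff forall_3 weight_eq_sum dot_def sum_3)
  then have "F = affine_frame 0 (h (vector [1, 1, 1]))"
    using F(2) by (intro affine_frame_eqI) (simp_all add: h_def)
  then show ?thesis ..
qed

lemma parseval_set_eq_affine_frame_4:
  fixes F :: "(bit ^ 4) set"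
  assumes F: "parseval_set F" "0 \<notin> F"
  shows "\<exists>a b. F = affine_frame a b"
proof -
  define h :: "bit ^ 4 \<Rightarrow> bit" where "h x = of_bool (x \<in> F)" for x
  \<comment> \<open>Interpolation at the vector of weight \<open>4\<close> and those of weight \<open>3\<close>, where the indicator of the
    standard basis vanishes.\<close>
  define u where "u = h (vector [1, 1, 1, 1])"
  define a where "a = (vector [u + h (vector [0, 1, 1, 1]), u + h (vector [1, 0, 1, 1]),
    u + h (vector [1, 1, 0, 1]), u + h (vector [1, 1, 1, 0])] :: bit ^ 4)"
  define b where "b = u + a $ 1 + a $ 2 + a $ 3 + a $ 4"
  have eq: "(\<Sum>v\<in>UNIV. h v * (v $ p * v $ q)) = of_bool (p = q)" for p q
    using F(1) unfolding parseval_set_def sum_times_indicator[of _ F] h_def by blast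
  \<comment> \<open>Ten equations leave five of the fifteen values free; the values at the five
    interpolation vectors determine the others.\<close>
  have "\<forall>x. x \<noteq> 0 \<longrightarrow> h x = of_bool (weight x = 1) + dot a x + b"
    using eq[of 1 1] eq[of 1 2] eq[of 1 3] eq[of 1 4] eq[of 2 2] eq[of 2 3] eq[of 2 4]
      eq[of 3 3] eq[of 3 4] eq[of 4 4]
    unfolding forall_vector_4 all_bit
    by (simp add: sum_bit_4 vec_eq_iff forall_4 weight_eq_sum dot_def sum_4 a_def b_def u_def)
      (cases "h (vector [1, 1, 1, 1])"; cases "h (vector [0, 1, 1, 1])";
        cases "h (vector [1, 0, 1, 1])";
        cases "h (vector [1, 1, 0, 1])"; cases "h (vector [1, 1, 1, 0])"; simp)
  then have "F = affine_frame a b"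
    using F(2) by (intro affine_frame_eqI) (simp_all add: h_def)
  then show ?thesis by blast
qed


section \<open>Unitary images of affine frames\<close>

lemma affine_frame_image:
  assumes U: "unitary U"
    and eq: "\<And>x. of_bool (weight (U *v x) = 1) + dot a' (U *v x) + b' =
      of_bool (weight x = 1) + dot a x + b"
  shows "affine_frame a' b' = (*v) U ` affine_frame a b"
proof -
  have U': "unitary (transpose U)"
    using U by (simp add: unitary_iff)
  have "U *v (transpose U *v y) = y" for y
    using transpose_unitary_cancel[OF U', of y] by simp
  moreover have "U *v x = 0 \<longleftrightarrow> x = 0" for x
    by (metis U matrix_vector_mult_0_right transpose_unitary_cancel)
  then have "U *v x \<in> affine_frame a' b' \<longleftrightarrow> x \<in> affine_frame a b" for x
    unfolding affine_frame_def by (simp add: eq del: One_nat_def)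
  ultimately show ?thesis
    by (metis (no_types, lifting) image_iff subsetI subset_antisym)
qed

text \<open>A bijection between the supports is glued to one between their complements.\<close>

lemma bij_of_weight_eq:
  fixes a a' :: "bit ^ 'n"
  assumes "weight a = weight a'"
  obtains \<sigma> where "bij \<sigma>" "\<And>i. a' $ i = a $ \<sigma> i"
proof -
  let ?S = "{i. a $ i = 1}" and ?S' = "{i. a' $ i = 1}"
  have "card ?S' = card ?S" "card (- ?S') = card (- ?S)"
    using assms by (simp_all add: weight_def Compl_eq_Diff_UNIV card_Diff_subset)
  then obtain f g where fg: "bij_betw f ?S' ?S" "bij_betw g (- ?S') (- ?S)"
    by (metis finite finite_same_card_bij)
  let ?\<sigma> = "\<lambda>i. if i \<in> ?S' then f i else g i"
  have "bij_betw ?\<sigma> (?S' \<union> - ?S') (?S \<union> - ?S)"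
    using fg by (intro bij_betw_disjoint_Un) auto
  then have "bij ?\<sigma>" by simp
  moreover have "a' $ i = a $ ?\<sigma> i" for i
    using bij_betwE[OF fg(1)] bij_betwE[OF fg(2)] by (cases "a' $ i") auto
  ultimately show thesis using that by blast
qed

definition perm_matrix :: "('n \<Rightarrow> 'n) \<Rightarrow> bit ^ 'n ^ 'n" where
  "perm_matrix \<sigma> = (\<chi> i j. of_bool (j = \<sigma> i))"

lemma perm_matrix_mult_nth: "(perm_matrix \<sigma> *v x) $ i = x $ \<sigma> i"
  by (simp add: perm_matrix_def matrix_vector_mult_def of_bool_def if_distrib[of "\<lambda>c. c * _"] cong: if_cong)

lemma transpose_perm_matrix:
  assumes "bij \<sigma>"
  shows "transpose (perm_matrix \<sigma>) = perm_matrix (inv \<sigma>)"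
  using bij_inv_eq_iff[OF assms] by (auto simp: perm_matrix_def transpose_def vec_eq_iff)

lemma unitary_perm_matrix:
  assumes "bij \<sigma>"
  shows "unitary (perm_matrix \<sigma>)"
  unfolding unitary_iff transpose_perm_matrix[OF assms]
  using assms
  by (simp add: matrix_eq vec_eq_iff perm_matrix_mult_nth bij_is_inj bij_is_surj surj_f_inv_f
      flip: matrix_vector_mul_assoc)

lemma weight_perm_matrix:
  assumes "bij \<sigma>"
  shows "weight (perm_matrix \<sigma> *v x) = weight x"
  unfolding weight_eq_sum perm_matrix_mult_nth
  by (rule sum.reindex_bij_betw[OF assms])

lemma dot_perm_matrix:
  assumes "bij \<sigma>"
  shows "dot (perm_matrix \<sigma> *v a) (perm_matrix \<sigma> *v x) = dot a x"
  unfolding dot_def perm_matrix_mult_nth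
  by (rule sum.reindex_bij_betw[OF assms])

text \<open>Coordinate permutations preserve \<open>weight\<close> and \<open>dot\<close>, so one
  taking \<open>a\<close> to \<open>a'\<close> carries the frames along.\<close>

lemma affine_frame_image_of_weight_eq:
  fixes a a' :: "bit ^ 'n"
  assumes "weight a = weight a'"
  shows "\<exists>U. unitary U \<and> affine_frame a' b = (*v) U ` affine_frame a b"
proof -
  obtain \<sigma> where \<sigma>: "bij \<sigma>" "\<And>i. a' $ i = a $ \<sigma> i"
    using bij_of_weight_eq[OF assms] by blast
  then have "a' = perm_matrix \<sigma> *v a"
    by (simp add: vec_eq_iff perm_matrix_mult_nth)
  with \<sigma> have "affine_frame a' b = (*v) (perm_matrix \<sigma>) ` affine_frame a b"
    by (intro affine_frame_image) (simp_all add: unitary_perm_matrix weight_perm_matrix dot_perm_matrix)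
  then show ?thesis
    using unitary_perm_matrix[OF \<sigma>(1)] by blast
qed

text \<open>This is \<open>I + J\<close> with \<open>J\<close> the all-ones matrix: it fixes vectors
  of even weight and complements those of odd weight.\<close>

definition flip_matrix :: "bit ^ 4 ^ 4" where
  "flip_matrix = (\<chi> i j. of_bool (i \<noteq> j))"

text \<open>\<open>I + J\<close> is symmetric and \<open>J\<close> squares to
  \<open>4 J = 0\<close>, so \<open>I + J\<close> is its own inverse.\<close>

lemma unitary_flip_matrix: "unitary flip_matrix"
  unfolding unitary_iff flip_matrix_def
  by (simp add: vec_eq_iff forall_4 matrix_matrix_mult_def transpose_def mat_def sum_4)

text \<open>Adding \<open>dot 1 x\<close> to the indicator of weight 1 gives the indicator of weight
  3, and the flip exchanges these two weights.\<close>

lemma affine_frame_flip: "affine_frame 1 b = (*v) flip_matrix ` affine_frame 0 b"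
proof (rule affine_frame_image[OF unitary_flip_matrix])
  have "\<forall>x :: bit ^ 4. of_bool (weight (flip_matrix *v x) = 1) + dot 1 (flip_matrix *v x) =
      (of_bool (weight x = 1) + dot 0 x :: bit)"
    unfolding forall_vector_4 all_bit
    by (simp add: flip_matrix_def matrix_vector_mult_def weight_eq_sum dot_def sum_4)
  then show "of_bool (weight (flip_matrix *v x) = 1) + dot 1 (flip_matrix *v x) + b =
      of_bool (weight x = 1) + dot 0 x + b" for x
    by simp
qed

section \<open>Sizes of affine frames\<close>

lemma weight_eq_0_iff: "weight a = 0 \<longleftrightarrow> a = 0"
  by (auto simp: weight_def vec_eq_iff)

lemma weight_eq_CARD_iff: "weight (a :: bit ^ 'n) = CARD('n) \<longleftrightarrow> a = 1"
proof -
  have "weight a = CARD('n) \<longleftrightarrow> {i. a $ i = 1} = UNIV"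
    using card_subset_eq[of UNIV "{i. a $ i = 1}"] by (auto simp: weight_def)
  then show ?thesis by (auto simp: vec_eq_iff)
qed

lemma card_eq_sum: "card (F :: 'a :: finite set) = (\<Sum>x\<in>UNIV. of_bool (x \<in> F))"
  by simp

lemma card_affine_frame_3: "card (affine_frame (0 :: bit ^ 3) b) = (if b = 0 then 3 else 4)"
  unfolding card_eq_sum
  by (cases b) (simp_all add: affine_frame_def sum_bit_3 vec_eq_iff forall_3 weight_eq_sum dot_def sum_3)

text \<open>For \<open>a \<noteq> 0\<close> and \<open>b = 0\<close> the frame is the symmetric
  difference of the 4 basis vectors and the 8 vectors with \<open>dot a x = 1\<close>, which share
  \<open>weight a\<close> elements. Taking \<open>b = 1\<close> instead gives the complement among
  the 15 nonzero vectors.\<close>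

lemma card_affine_frame_4:
  "card (affine_frame (a :: bit ^ 4) b) =
    (if weight a = 0 then if b = 0 then 4 else 11
     else if b = 0 then 12 - 2 * weight a else 3 + 2 * weight a)"
proof -
  have "\<forall>a b. card (affine_frame (a :: bit ^ 4) b) =
    (if weight a = 0 then if b = 0 then 4 else 11
     else if b = 0 then 12 - 2 * weight a else 3 + 2 * weight a)"
    unfolding forall_vector_4 all_bit card_eq_sum
    by (simp add: affine_frame_def sum_bit_4 vec_eq_iff forall_4 weight_eq_sum dot_def sum_4)
  then show ?thesis by blast
qed

section \<open>Affine frames are Parseval\<close>

lemma parseval_set_affine_frame:
  fixes a :: "bit ^ 'n"
  assumes "\<And>p q. (\<Sum>v\<in>UNIV. (of_bool (weight v = 1) + dot a v + b) * (v $ p * v $ q)) = of_bool (p = q)"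
  shows "parseval_set (affine_frame a b)"
proof -
  \<comment> \<open>At \<open>v = 0\<close> the product of coordinates vanishes, so both sides agree
    there too.\<close>
  have indicator: "of_bool (v \<in> affine_frame a b) * (v $ p * v $ q) =
      (of_bool (weight v = 1) + dot a v + b) * (v $ p * v $ q)" for v p q
    by (cases "v = 0"; cases "of_bool (weight v = 1) + dot a v + b")
      (auto simp: affine_frame_def)
  show ?thesis
    unfolding parseval_set_def sum_times_indicator[of _ "affine_frame a b"] indicator
    using assms by blast
qed

text \<open>The basis indicator contributes \<open>of_bool (p = q)\<close>; the rest is a polynomial
  of degree below the number of variables and sums to 0 over the space.\<close>

lemma parseval_set_affine_frame_3: "parseval_set (affine_frame (0 :: bit ^ 3) b)"
proof (rule parseval_set_affine_frame)
  have "\<forall>p q. (\<Sum>v\<in>UNIV. (of_bool (weight v = 1) + dot (0 :: bit ^ 3) v + b) * (v $ p * v $ q)) = of_bool (p = q)"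
    by (cases b) (simp_all add: forall_3 sum_bit_3 weight_eq_sum dot_def sum_3)
  then show "(\<Sum>v\<in>UNIV. (of_bool (weight v = 1) + dot (0 :: bit ^ 3) v + b) * (v $ p * v $ q)) = of_bool (p = q)" for p q
    by blast
qed

text \<open>An affine function times two coordinates has degree at most 3, still below 4.\<close>

lemma parseval_set_affine_frame_4: "parseval_set (affine_frame (a :: bit ^ 4) b)"
proof (rule parseval_set_affine_frame)
  have "\<forall>p q. (\<Sum>v\<in>UNIV. (of_bool (weight v = 1) + dot a v + b) * (v $ p * v $ q)) = of_bool (p = q)"
    by (simp add: forall_4 sum_bit_4 weight_eq_sum dot_def sum_4)
  then show "(\<Sum>v\<in>UNIV. (of_bool (weight v = 1) + dot a v + b) * (v $ p * v $ q)) = of_bool (p = q)" for p q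
    by blast
qed

lemma zero_notin_affine_frame: "0 \<notin> affine_frame a b"
  by (simp add: affine_frame_def)

section \<open>Counting the switching classes\<close>

lemma mem_nonredundant_parseval_frames_iff:
  "fs \<in> nonredundant_parseval_frames k \<longleftrightarrow>
    distinct fs \<and> 0 \<notin> set fs \<and> parseval_set (set fs) \<and> card (set fs) = k"
  by (auto simp: nonredundant_parseval_frames_def not_trivially_redundant_iff
      parseval_frame_iff_parseval_set distinct_card)

lemma nonredundant_parseval_frames_nonempty:
  fixes F :: "(bit ^ 'n) set"
  assumes "parseval_set F" "0 \<notin> F" "card F = k"
  shows "nonredundant_parseval_frames k \<noteq> ({} :: (bit ^ 'n) list set)"
proof -
  obtain fs where "distinct fs" "set fs = F"
    using finite_distinct_list[of F] by auto
  then have "fs \<in> nonredundant_parseval_frames k"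
    using assms by (simp add: mem_nonredundant_parseval_frames_iff)
  then show ?thesis by blast
qed

lemma card_quotient_eq_1:
  assumes "A \<noteq> {}" and "\<And>fs gs. fs \<in> A \<Longrightarrow> gs \<in> A \<Longrightarrow> switching_equivalent fs gs"
  shows "card (A // switching_rel) = 1"
proof -
  obtain fs where fs: "fs \<in> A" using \<open>A \<noteq> {}\<close> by blast
  have "switching_rel `` {gs} = switching_rel `` {fs}" if "gs \<in> A" for gs
    using assms(2)[OF that fs]
    by (intro equiv_class_eq[OF equiv_switching_rel]) (simp add: switching_rel_def)
  then have "(\<lambda>gs. switching_rel `` {gs}) ` A = (\<lambda>_. switching_rel `` {fs}) ` A"
    by (rule image_cong[OF refl])
  then have "A // switching_rel = {switching_rel `` {fs}}"
    unfolding quotient_def UNION_singleton_eq_range using fs by (simp only: image_constant)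
  then show ?thesis by simp
qed

lemma switching_equivalent_3:
  fixes fs gs :: "(bit ^ 3) list"
  assumes "fs \<in> nonredundant_parseval_frames k" "gs \<in> nonredundant_parseval_frames k"
  shows "switching_equivalent fs gs"
proof -
  have fs: "distinct fs" "0 \<notin> set fs" "parseval_set (set fs)" "card (set fs) = k"
    and gs: "distinct gs" "0 \<notin> set gs" "parseval_set (set gs)" "card (set gs) = k"
    using assms by (auto simp: mem_nonredundant_parseval_frames_iff)
  obtain b b' where "set fs = affine_frame 0 b" "set gs = affine_frame 0 b'"
    using parseval_set_eq_affine_frame_3 fs(2,3) gs(2,3) by meson
  \<comment> \<open>The size separates the two values of \<open>b\<close>, so both lists have the
    same set and the identity matrix serves.\<close>
  moreover from this have "b = b'"
    using fs(4) gs(4) by (cases b; cases b') (auto simp: card_affine_frame_3)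
  ultimately have "set fs = (*v) (mat 1) ` set gs" by simp
  moreover have "unitary (mat 1 :: bit ^ 3 ^ 3)" by (simp add: unitary_iff)
  ultimately show ?thesis
    using fs(1) gs(1) switching_equivalentI by blast
qed

lemma affine_frame_4_image:
  fixes a a' :: "bit ^ 4"
  assumes card: "card (affine_frame a b) = card (affine_frame a' b')" and le: "weight a \<le> weight a'"
  shows "\<exists>U. unitary U \<and> affine_frame a' b' = (*v) U ` affine_frame a b"
proof -
  have "weight a' \<le> 4"
    using card_mono[of UNIV "{i. a' $ i = 1}"] by (simp add: weight_def)
  \<comment> \<open>The size is even exactly for \<open>b = 0\<close>. Given \<open>b\<close>, it
    determines the weight, except that 0 and 4 both give size 4 or both give 11; \<open>le\<close>
    orders these two.\<close>
  then have "b = b' \<and> (weight a = weight a' \<or> weight a = 0 \<and> weight a' = 4)"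
    using card le by (auto simp: card_affine_frame_4 split: if_splits) presburger+
  then consider "b = b'" "weight a = weight a'" | "b = b'" "a = 0" "a' = 1"
    using weight_eq_CARD_iff[of a'] by (auto simp: weight_eq_0_iff)
  then show ?thesis
  proof cases
    case 1
    then show ?thesis using affine_frame_image_of_weight_eq by blast
  next
    case 2
    then show ?thesis using affine_frame_flip unitary_flip_matrix by blast
  qed
qed

lemma switching_equivalent_4:
  fixes fs gs :: "(bit ^ 4) list"
  assumes "fs \<in> nonredundant_parseval_frames k" "gs \<in> nonredundant_parseval_frames k"
  shows "switching_equivalent fs gs"
proof -
  have fs: "distinct fs" "0 \<notin> set fs" "parseval_set (set fs)" "card (set fs) = k"
    and gs: "distinct gs" "0 \<notin> set gs" "parseval_set (set gs)" "card (set gs) = k"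
    using assms by (auto simp: mem_nonredundant_parseval_frames_iff)
  obtain a b a' b' where ab: "set fs = affine_frame a b" and ab': "set gs = affine_frame a' b'"
    using parseval_set_eq_affine_frame_4 fs(2,3) gs(2,3) by meson
  \<comment> \<open>\<open>affine_frame_4_image\<close> maps the smaller weight to the larger;
    symmetry of switching covers the other direction.\<close>
  consider "weight a \<le> weight a'" | "weight a' \<le> weight a" by linarith
  then show ?thesis
  proof cases
    case 1
    then have "\<exists>U. unitary U \<and> set gs = (*v) U ` set fs"
      unfolding ab ab' using fs(4) gs(4) ab ab' by (intro affine_frame_4_image) simp_all
    then show ?thesis
      using fs(1) gs(1) switching_equivalentI switching_equivalent_sym by blast
  next
    case 2
    then have "\<exists>U. unitary U \<and> set fs = (*v) U ` set gs"
      unfolding ab ab' using fs(4) gs(4) ab ab' by (intro affine_frame_4_image) simp_all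
    then show ?thesis
      using fs(1) gs(1) switching_equivalentI by blast
  qed
qed

lemma nonredundant_parseval_frames_3_nonempty:
  assumes "k \<in> {3, 4}"
  shows "nonredundant_parseval_frames k \<noteq> ({} :: (bit ^ 3) list set)"
proof -
  have "card (affine_frame (0 :: bit ^ 3) (if k = 3 then 0 else 1)) = k"
    using assms by (auto simp: card_affine_frame_3)
  then show ?thesis
    by (rule nonredundant_parseval_frames_nonempty[OF parseval_set_affine_frame_3 zero_notin_affine_frame])
qed

lemma nonredundant_parseval_frames_4_nonempty:
  assumes "k \<in> {4, 5, 6, 7, 8, 9, 10, 11}"
  shows "nonredundant_parseval_frames k \<noteq> ({} :: (bit ^ 4) list set)"
proof -
  have w: "weight (vector [1, 0, 0, 0] :: bit ^ 4) = 1" "weight (vector [1, 1, 0, 0] :: bit ^ 4) = 2"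
    "weight (vector [1, 1, 1, 0] :: bit ^ 4) = 3" "weight (vector [1, 1, 1, 1] :: bit ^ 4) = 4"
    by (simp_all add: weight_eq_sum sum_4)
  have "\<exists>a b. card (affine_frame (a :: bit ^ 4) b) = k"
  proof -
    \<comment> \<open>\<open>12 - 2 * w\<close> yields the even sizes 10, 8, 6, 4 and
      \<open>3 + 2 * w\<close> the odd sizes 5, 7, 9, 11.\<close>
    have "\<exists>w\<in>{1, 2, 3, 4}. k = 12 - 2 * w \<or> k = 3 + 2 * w"
      using assms by auto
    then obtain a :: "bit ^ 4" where "weight a \<noteq> 0" "k = 12 - 2 * weight a \<or> k = 3 + 2 * weight a"
      using w by (metis insertE numeral_eq_one_iff singletonD zero_neq_numeral zero_neq_one)
    then have "card (affine_frame a 0) = k \<or> card (affine_frame a 1) = k"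
      by (auto simp: card_affine_frame_4)
    then show ?thesis by blast
  qed
  then show ?thesis
    using nonredundant_parseval_frames_nonempty[OF parseval_set_affine_frame_4 zero_notin_affine_frame]
    by blast
qed

theorem mainTheorem5:
  shows "(\<forall>k\<in>{3, 4}.
            card ((nonredundant_parseval_frames k :: (bit ^ 3) list set) // switching_rel) = 1) \<and>
         (\<forall>k\<in>{4, 5, 6, 7, 8, 9, 10, 11}.
            card ((nonredundant_parseval_frames k :: (bit ^ 4) list set) // switching_rel) = 1)"
proof (intro conjI ballI)
  fix k :: nat
  assume "k \<in> {3, 4}"
  then show "card ((nonredundant_parseval_frames k :: (bit ^ 3) list set) // switching_rel) = 1"
    by (rule card_quotient_eq_1[OF nonredundant_parseval_frames_3_nonempty switching_equivalent_3])
next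
  fix k :: nat
  assume "k \<in> {4, 5, 6, 7, 8, 9, 10, 11}"
  then show "card ((nonredundant_parseval_frames k :: (bit ^ 4) list set) // switching_rel) = 1"
    by (rule card_quotient_eq_1[OF nonredundant_parseval_frames_4_nonempty switching_equivalent_4])
qed

end
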